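(* Let $u=(u_1,\dots,u_n)$ be admissible (i.e. $u_j\in\mathcal A$ for every node $j$) and such that $\eta$ is strictly convex at each $u_j$ (i.e. $\nabla^2\eta(u_j)$ is positive definite). For each node $i$ let $\hat\theta_i=(\hat\theta_{ij})_{j}\in\mathbb{R}^n$ be the optimal solution of $$\min\left\{\hat\theta^T\hat\theta \;:\; \hat\theta\in\mathbb{R}^n,\ a_i^T\hat\theta\ge b_i,\ \hat\theta\ge 0\right\},$$ with $a_i,b_i$ as defined in the context, and set $\theta_{ij}=\max\{\hat\theta_{ij},\hat\theta_{ji}\}$. Then the blended scheme $$M\frac{\mathrm du}{\mathrm dt}+r=0,\qquad r_i=\sum_j\lVert n_{ij}\rVert f_{ij}(\theta_{ij}),$$ applied with the diffusion coefficients $\theta_{ij}$, is entropy stable; that is, at every node $i$ it satisfies the semi-discrete entropy inequality $$v_i^T\frac{\mathrm du_i}{\mathrm dt}+\frac{1}{M_{ii}}\sum_j\lVert n_{ij}\rVert\left(v_j^Tf_{ij}(\theta_{ij})-(\psi(u_j)-\psi(u_i))\cdot\hat n_{ij}\right)\le 0.$$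
   Context: Conservation law: $\partial_t \mathbf u+\sum_{k=1}^d\partial_{x_k}\mathbf f_k(\mathbf u)=0$ with $v$ variables in $d$ space dimensions and fluxes $\mathbf f_1,\dots,\mathbf f_d$ taking values in $\mathbb{R}^v$. Let $\mathbf f(\mathbf u)\in\mathbb{R}^{v\times d}$ be the matrix whose $k$-th column is $\mathbf f_k(\mathbf u)$; for $\hat n\in\mathbb{R}^d$, $\mathbf f(\mathbf u)\cdot\hat n=\sum_k \hat n_k\mathbf f_k(\mathbf u)\in\mathbb{R}^v$. Entropy: states lie in an open convex set $\mathcal A\subseteq\mathbb{R}^v$ of admissible states, on which the fluxes $\mathbf f_k$, the entropy function $\eta$ and the entropy fluxes $F_k$ are defined and differentiable. $\eta:\mathcal A\to\mathbb{R}$ is $C^2$ and convex, and $(\eta,F_k)$ are entropy/entropy-flux pairs: with entropy variables $\mathbf v(\mathbf u)=\nabla_{\mathbf u}\eta(\mathbf u)$ one has $\frac{\partial F_k}{\partial \mathbf u}=\mathbf v^T\frac{\partial \mathbf f_k}{\partial\mathbf u}$. The entropy potentials are $\psi_k(\mathbf u)=\mathbf v(\mathbf u)^T\mathbf f_k(\mathbf u)-F_k(\mathbf u)$, and $\psi=(\psi_1,\dots,\psi_d)$. The semi-discrete nodal entropy inequality is a discretization at node $i$ of $\partial_t\eta(\mathbf u)+\sum_k\partial_{x_k}F_k(\mathbf u)\le0$. Discretization: there are $n$ nodes; $u_i(t)\in\mathbb{R}^v$ is the nodal state at node $i$ and $v_i=\mathbf v(u_i)$. $M\in\mathbb{R}^{n\times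 n}$ is a diagonal mass matrix with positive diagonal entries $M_{ii}>0$, so the scheme reads $M_{ii}\frac{\mathrm du_i}{\mathrm dt}+r_i=0$ for each $i$. $D_1,\dots,D_d\in\mathbb{R}^{n\times n}$ are finite difference matrices with $D_k\mathbf 1=0$. Set $n_{ij}\in\mathbb{R}^d$, $(n_{ij})_k=2(D_k)_{ij}$, and $\hat n_{ij}=n_{ij}/\lVert n_{ij}\rVert$; any term multiplied by $\lVert n_{ij}\rVert=0$ is taken to be zero. The high order (central) flux is $f_{ij}^H=\frac{\mathbf f(u_i)+\mathbf f(u_j)}{2}\cdot\hat n_{ij}$, and for $\theta\ge0$ the flux with artificial viscosity is $f_{ij}(\theta)=f_{ij}^H+\theta\,(u_i-u_j)$. Definitions of $a_i\in\mathbb{R}^n$ and $b_i\in\mathbb{R}$ (sums over all nodes $j$): $$(a_i)_j=a_{ij}=\lVert n_{ij}\rVert\,(v_j-v_i)^T(u_j-u_i),$$ $$b_i=\sum_j\lVert n_{ij}\rVert\left[(v_j-v_i)^Tf_{ij}^H-(\psi(u_j)-\psi(u_i))\cdot\hat n_{ij}\right].$$ *)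

theory Defs
  imports "HOL-Analysis.Analysis"
begin

section \<open>Entropy, entropy fluxes and entropy potentials\<close>

text \<open>
  States are vectors of type \<open>real ^ 'v\<close>, spatial directions are indexed by \<open>'d\<close>, nodes by \<open>'n\<close>.
  All functions of the state are total; they are constrained only on the open set of
  admissible states.
\<close>

definition gradient :: "(real ^ 'v \<Rightarrow> real) \<Rightarrow> real ^ 'v \<Rightarrow> real ^ 'v" where
  "gradient \<eta> u = (\<chi> a. frechet_derivative \<eta> (at u) (axis a 1))"

definition hessian :: "(real ^ 'v \<Rightarrow> real) \<Rightarrow> real ^ 'v \<Rightarrow> real ^ 'v ^ 'v" where
  "hessian \<eta> u = jacobian (gradient \<eta>) (at u)"

text \<open>Intended for open \<open>A\<close>; then this is twice continuous differentiability.\<close>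

definition C2_on :: "(real ^ 'v) set \<Rightarrow> (real ^ 'v \<Rightarrow> real) \<Rightarrow> bool" where
  "C2_on A \<eta> \<longleftrightarrow>
     (\<forall>u\<in>A. \<eta> differentiable (at u)) \<and>
     (\<forall>u\<in>A. gradient \<eta> differentiable (at u)) \<and>
     continuous_on A (hessian \<eta>)"

definition pos_definite :: "real ^ 'v ^ 'v \<Rightarrow> bool" where
  "pos_definite H \<longleftrightarrow> (\<forall>h. h \<noteq> 0 \<longrightarrow> 0 < h \<bullet> (H *v h))"

text \<open>The last condition is \<open>\<partial>F\<^sub>k/\<partial>u = v\<^sup>T \<partial>f\<^sub>k/\<partial>u\<close> with the entropy variables \<open>v = \<nabla>\<eta>\<close>.\<close>

definition entropy_pair_on ::
  "(real ^ 'v) set \<Rightarrow> (real ^ 'v \<Rightarrow> real) \<Rightarrow> (real ^ 'v \<Rightarrow> real) \<Rightarrow> (real ^ 'v \<Rightarrow> real ^ 'v) \<Rightarrow> bool"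
where
  "entropy_pair_on A \<eta> F f \<longleftrightarrow>
     (\<forall>u\<in>A. f differentiable (at u) \<and> F differentiable (at u) \<and>
            gradient F u = gradient \<eta> u v* jacobian f (at u))"

definition entropy_potential ::
  "(real ^ 'v \<Rightarrow> real) \<Rightarrow> ('d::finite \<Rightarrow> real ^ 'v \<Rightarrow> real) \<Rightarrow> ('d::finite \<Rightarrow> real ^ 'v \<Rightarrow> real ^ 'v) \<Rightarrow>
   real ^ 'v \<Rightarrow> real ^ 'd"
where
  "entropy_potential \<eta> F f u = (\<chi> k. gradient \<eta> u \<bullet> f k u - F k u)"

section \<open>Discretization\<close>

definition flux_matrix ::
  "('d::finite \<Rightarrow> real ^ 'v \<Rightarrow> real ^ 'v) \<Rightarrow> real ^ 'v \<Rightarrow> real ^ 'd ^ 'v" where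
  "flux_matrix f u = (\<chi> a k. f k u $ a)"

definition nvec :: "('d::finite \<Rightarrow> real ^ 'n ^ 'n) \<Rightarrow> 'n \<Rightarrow> 'n \<Rightarrow> real ^ 'd" where
  "nvec D i j = (\<chi> k. 2 * D k $ i $ j)"

text \<open>
  If \<open>nvec D i j = 0\<close> then \<open>nhat D i j = 0\<close>; it only ever occurs multiplied by
  \<open>norm (nvec D i j)\<close>, so such terms vanish.
\<close>

definition nhat :: "('d::finite \<Rightarrow> real ^ 'n ^ 'n) \<Rightarrow> 'n \<Rightarrow> 'n \<Rightarrow> real ^ 'd" where
  "nhat D i j = nvec D i j /\<^sub>R norm (nvec D i j)"

definition flux_H ::
  "('d::finite \<Rightarrow> real ^ 'v \<Rightarrow> real ^ 'v) \<Rightarrow> ('d::finite \<Rightarrow> real ^ 'n ^ 'n) \<Rightarrow> real ^ 'v ^ 'n \<Rightarrow>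
   'n \<Rightarrow> 'n \<Rightarrow> real ^ 'v"
where
  "flux_H f D u i j =
     ((1 / 2) *\<^sub>R (flux_matrix f (u $ i) + flux_matrix f (u $ j))) *v nhat D i j"

definition flux_visc ::
  "('d::finite \<Rightarrow> real ^ 'v \<Rightarrow> real ^ 'v) \<Rightarrow> ('d::finite \<Rightarrow> real ^ 'n ^ 'n) \<Rightarrow> real ^ 'v ^ 'n \<Rightarrow>
   'n \<Rightarrow> 'n \<Rightarrow> real \<Rightarrow> real ^ 'v"
where
  "flux_visc f D u i j \<theta> = flux_H f D u i j + \<theta> *\<^sub>R (u $ i - u $ j)"

definition residual ::
  "('d::finite \<Rightarrow> real ^ 'v \<Rightarrow> real ^ 'v) \<Rightarrow> ('d::finite \<Rightarrow> real ^ 'n ^ 'n) \<Rightarrow> real ^ 'v ^ 'n \<Rightarrow>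
   real ^ 'n ^ 'n \<Rightarrow> real ^ 'v ^ 'n"
where
  "residual f D u \<theta> =
     (\<chi> i. \<Sum>j\<in>UNIV. norm (nvec D i j) *\<^sub>R flux_visc f D u i j (\<theta> $ i $ j))"

section \<open>The quadratic program for the diffusion coefficients\<close>

definition avec ::
  "(real ^ 'v \<Rightarrow> real) \<Rightarrow> ('d::finite \<Rightarrow> real ^ 'n ^ 'n) \<Rightarrow> real ^ 'v ^ 'n \<Rightarrow> 'n \<Rightarrow> real ^ 'n"
where
  "avec \<eta> D u i =
     (\<chi> j. norm (nvec D i j) *
            ((gradient \<eta> (u $ j) - gradient \<eta> (u $ i)) \<bullet> (u $ j - u $ i)))"

definition bval ::
  "(real ^ 'v \<Rightarrow> real) \<Rightarrow> ('d::finite \<Rightarrow> real ^ 'v \<Rightarrow> real) \<Rightarrow> ('d::finite \<Rightarrow> real ^ 'v \<Rightarrow> real ^ 'v) \<Rightarrow>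
   ('d::finite \<Rightarrow> real ^ 'n ^ 'n) \<Rightarrow> real ^ 'v ^ 'n \<Rightarrow> 'n \<Rightarrow> real"
where
  "bval \<eta> F f D u i =
     (\<Sum>j\<in>UNIV. norm (nvec D i j) *
        ((gradient \<eta> (u $ j) - gradient \<eta> (u $ i)) \<bullet> flux_H f D u i j
          - (entropy_potential \<eta> F f (u $ j) - entropy_potential \<eta> F f (u $ i)) \<bullet> nhat D i j))"

definition qp_solution ::
  "(real ^ 'v \<Rightarrow> real) \<Rightarrow> ('d::finite \<Rightarrow> real ^ 'v \<Rightarrow> real) \<Rightarrow> ('d::finite \<Rightarrow> real ^ 'v \<Rightarrow> real ^ 'v) \<Rightarrow>
   ('d::finite \<Rightarrow> real ^ 'n ^ 'n) \<Rightarrow> real ^ 'v ^ 'n \<Rightarrow> 'n \<Rightarrow> real ^ 'n \<Rightarrow> bool"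
where
  "qp_solution \<eta> F f D u i \<theta> \<longleftrightarrow>
     is_arg_min (\<lambda>x. x \<bullet> x)
       (\<lambda>x. bval \<eta> F f D u i \<le> avec \<eta> D u i \<bullet> x \<and> (\<forall>j. 0 \<le> x $ j)) \<theta>"

end

theory Submission
  imports Defs
begin

text \<open>
  With \<open>v\<^sub>i = \<nabla>\<eta>(u\<^sub>i)\<close>, inserting the scheme into the left-hand side of the entropy
  inequality turns it into \<open>(b\<^sub>i - a\<^sub>i\<^sup>T \<theta>\<^sub>i) / M\<^sub>i\<^sub>i\<close>. Since \<open>\<nabla>\<eta>\<close> is monotone, \<open>a\<^sub>i \<ge> 0\<close>,
  so enlarging the feasible point of row \<open>i\<close> to the symmetrized coefficients keeps this nonpositive.
  The program is the projection of \<open>0\<close> onto a closed convex set, so it only has to be feasible: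
  if \<open>a\<^sub>i = 0\<close>, strict convexity forces \<open>u\<^sub>j = u\<^sub>i\<close> whenever \<open>n\<^sub>i\<^sub>j \<noteq> 0\<close>, and then \<open>b\<^sub>i = 0\<close>.
\<close>

text \<open>A linear functional is the inner product with the vector of its values on the standard
  basis, which is how \<open>gradient\<close> is built.\<close>

lemma has_derivative_gradient:
  fixes \<eta> :: "real ^ 'v \<Rightarrow> real"
  assumes "\<eta> differentiable (at x)"
  shows "(\<eta> has_derivative (\<lambda>h. gradient \<eta> x \<bullet> h)) (at x)"
proof -
  let ?D = "frechet_derivative \<eta> (at x)"
  have D: "(\<eta> has_derivative ?D) (at x)"
    using assms frechet_derivative_works by blast
  then interpret D: linear ?D
    by (rule has_derivative_linear)
  have "?D h = gradient \<eta> x \<bullet> h" for h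
  proof -
    have "?D h = ?D (\<Sum>a\<in>UNIV. h $ a *s axis a 1)"
      by (simp add: basis_expansion)
    also have "\<dots> = (\<Sum>a\<in>UNIV. h $ a * ?D (axis a 1))"
      by (simp add: D.sum D.scaleR scalar_mult_eq_scaleR)
    also have "\<dots> = gradient \<eta> x \<bullet> h"
      by (simp add: gradient_def inner_vec_def mult.commute)
    finally show ?thesis .
  qed
  with D show ?thesis by (metis (no_types, lifting) ext)
qed

text \<open>Restriction to the line through \<open>x\<close> and \<open>y\<close> reduces this to
  the tangent inequality for convex functions of one real variable.\<close>

lemma convex_on_gradient_tangent:
  fixes \<eta> :: "real ^ 'v \<Rightarrow> real"
  assumes "open A" and conv: "convex_on A \<eta>" and diff: "\<eta> differentiable (at x)"
    and x: "x \<in> A" and y: "y \<in> A"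
  shows "gradient \<eta> x \<bullet> (y - x) \<le> \<eta> y - \<eta> x"
proof -
  let ?p = "\<lambda>s::real. x + s *\<^sub>R (y - x)"
  \<comment> \<open>All parameters whose point lies in \<open>A\<close> are kept, not just the
    segment from 0 to 1: the one-dimensional tangent inequality needs the base point 0 in the
    interior.\<close>
  define S where "S = ?p -` A"
  have "open S"
    unfolding S_def by (intro open_vimage \<open>open A\<close> continuous_intros)
  have p_comb: "?p ((1 - c) * s + c * r) = (1 - c) *\<^sub>R ?p s + c *\<^sub>R ?p r" for s r c
    by (simp add: algebra_simps)
  have cvS: "convex S"
    using convex_on_imp_convex[OF conv] p_comb by (auto simp: S_def convex_alt)
  have "convex_on S (\<lambda>s. \<eta> (?p s))"
  proof (rule convex_onI)
    show "convex S" by (rule cvS)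
    fix c s r :: real
    assume "0 < c" "c < 1" "s \<in> S" "r \<in> S"
    then show "\<eta> (?p ((1 - c) *\<^sub>R s + c *\<^sub>R r)) \<le> (1 - c) * \<eta> (?p s) + c * \<eta> (?p r)"
      using convex_onD[OF conv, of c "?p s" "?p r"] by (simp add: S_def p_comb)
  qed
  moreover have "((\<lambda>s. \<eta> (?p s)) has_real_derivative gradient \<eta> x \<bullet> (y - x)) (at 0 within S)"
  proof -
    have "(?p has_derivative (\<lambda>s. s *\<^sub>R (y - x))) (at 0 within S)"
      by (auto intro!: derivative_eq_intros)
    moreover have "(\<eta> has_derivative (\<lambda>h. gradient \<eta> x \<bullet> h)) (at (?p 0))"
      using has_derivative_gradient[OF diff] by simp
    ultimately have "((\<lambda>s. \<eta> (?p s)) has_derivative (\<lambda>s. gradient \<eta> x \<bullet> (s *\<^sub>R (y - x)))) (at 0 within S)"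
      by (rule has_derivative_compose)
    then show ?thesis
      by (simp add: has_field_derivative_def mult.commute[of _ "gradient \<eta> x \<bullet> (y - x)"] mult_commute_abs)
  qed
  ultimately have "\<eta> (?p 1) - \<eta> (?p 0) \<ge> gradient \<eta> x \<bullet> (y - x) * (1 - 0)"
    using \<open>open S\<close> x y
    by (intro convex_on_imp_above_tangent[where A = S])
       (auto simp: S_def interior_open convex_connected cvS[unfolded S_def])
  then show ?thesis by simp
qed

text \<open>In the sum of the tangent inequalities at \<open>x\<close> and at \<open>y\<close> the
  values of \<eta> cancel.\<close>

lemma gradient_monotone:
  fixes \<eta> :: "real ^ 'v \<Rightarrow> real"
  assumes "open A" "convex_on A \<eta>" "\<forall>z\<in>A. \<eta> differentiable (at z)" "x \<in> A" "y \<in> A"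
  shows "0 \<le> (gradient \<eta> y - gradient \<eta> x) \<bullet> (y - x)"
  using convex_on_gradient_tangent[of A \<eta> x y] convex_on_gradient_tangent[of A \<eta> y x] assms
  by (simp add: inner_diff)

text \<open>Positive definiteness at \<open>x\<close> makes the component of the gradient along
  \<open>h\<close> increase strictly just after \<open>x\<close>; monotonicity on the rest of the
  segment preserves this gain up to \<open>y\<close>.\<close>

lemma gradient_strictly_monotone:
  fixes \<eta> :: "real ^ 'v \<Rightarrow> real"
  assumes "open A" "convex_on A \<eta>" "C2_on A \<eta>" "x \<in> A" "y \<in> A"
    and pd: "pos_definite (hessian \<eta> x)" and "x \<noteq> y"
  shows "0 < (gradient \<eta> y - gradient \<eta> x) \<bullet> (y - x)"
proof -
  define h where "h = y - x"
  let ?g = "gradient \<eta>" and ?p = "\<lambda>s::real. x + s *\<^sub>R h"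
  have "convex A" using assms(2) by (simp add: convex_on_def)
  have "(?g has_derivative (\<lambda>h. hessian \<eta> x *v h)) (at (?p 0))"
    using assms(3,4) by (simp add: C2_on_def hessian_def jacobian_works)
  moreover have "(?p has_derivative (\<lambda>s. s *\<^sub>R h)) (at 0)"
    by (auto intro!: derivative_eq_intros)
  ultimately have "((\<lambda>s. ?g (?p s)) has_derivative (\<lambda>s. hessian \<eta> x *v (s *\<^sub>R h))) (at 0)"
    by (rule has_derivative_compose[rotated])
  then have "((\<lambda>s. h \<bullet> ?g (?p s)) has_real_derivative h \<bullet> (hessian \<eta> x *v h)) (at 0)"
    using has_derivative_inner_right[of "\<lambda>s. ?g (?p s)" _ _ h]
    by (fastforce simp: has_field_derivative_def matrix_vector_mult_scaleR mult_commute_abs)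
  moreover have "0 < h \<bullet> (hessian \<eta> x *v h)"
    using pd \<open>x \<noteq> y\<close> by (simp add: pos_definite_def h_def)
  ultimately obtain d where "d > 0" and d: "\<And>s. 0 < s \<Longrightarrow> s < d \<Longrightarrow> h \<bullet> ?g x < h \<bullet> ?g (?p s)"
    using DERIV_pos_inc_right[of "\<lambda>s. h \<bullet> ?g (?p s)" _ 0] by auto
  \<comment> \<open>Below \<open>d\<close> for the strict local increase, and below 1 so that
    \<open>?p s\<close> lies on the segment and the factor \<open>1 - s\<close> can be
    cancelled.\<close>
  define s where "s = min d 1 / 2"
  have s: "0 < s" "s < d" "s < 1" using \<open>d > 0\<close> by (auto simp: s_def)
  have "?p s = (1 - s) *\<^sub>R x + s *\<^sub>R y" by (simp add: h_def algebra_simps)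
  then have "?p s \<in> A"
    using \<open>convex A\<close> assms(4,5) s by (simp add: convexD_alt)
  then have "0 \<le> (?g y - ?g (?p s)) \<bullet> (y - ?p s)"
    using assms(1-3,5) by (intro gradient_monotone[of A]) (auto simp: C2_on_def)
  also have "y - ?p s = (1 - s) *\<^sub>R h" by (simp add: h_def algebra_simps)
  finally have "h \<bullet> ?g (?p s) \<le> h \<bullet> ?g y"
    using s by (simp add: zero_le_mult_iff inner_diff inner_commute)
  with d[OF s(1,2)] show ?thesis
    by (simp add: h_def[symmetric] inner_commute[of _ h] inner_diff_right)
qed

text \<open>Minimizing \<open>x \<bullet> x\<close> means finding the point of \<open>S\<close>
  closest to the origin, so this is existence and uniqueness of the projection.\<close>

lemma ex1_min_norm_closed_convex:
  fixes S :: "'a::euclidean_space set"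
  assumes "closed S" "convex S" "S \<noteq> {}"
  shows "\<exists>!x. is_arg_min (\<lambda>x. x \<bullet> x) (\<lambda>x. x \<in> S) x"
proof -
  have *: "is_arg_min (\<lambda>x. x \<bullet> x) (\<lambda>x. x \<in> S) x \<longleftrightarrow> x \<in> S \<and> (\<forall>y\<in>S. dist 0 x \<le> dist 0 y)" for x
    by (auto simp: is_arg_min_linorder norm_le)
  show ?thesis
    unfolding * using closest_point_exists[OF assms(1,3), of 0]
      any_closest_point_unique[OF assms(2,1), of _ _ 0] by blast
qed

lemma ex1_min_norm_half_space_orthant:
  fixes a :: "real ^ 'n"
  assumes nonneg: "\<And>j. 0 \<le> a $ j" and b: "a = 0 \<Longrightarrow> b \<le> 0"
  shows "\<exists>!x. is_arg_min (\<lambda>x. x \<bullet> x) (\<lambda>x. b \<le> a \<bullet> x \<and> (\<forall>j. 0 \<le> x $ j)) x"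
proof -
  let ?S = "{x. b \<le> a \<bullet> x} \<inter> (\<Inter>j. {x. 0 \<le> x $ j})"
  have "closed ?S"
    by (intro closed_Int closed_INT closed_Collect_le continuous_intros ballI)
  moreover have "convex ?S"
    using convex_halfspace_ge[of b a]
    by (intro convex_Int convex_INT) (auto simp: convex_def)
  \<comment> \<open>For nonzero \<open>a\<close> this multiple has inner product
    \<open>\<bar>b\<bar>\<close> with \<open>a\<close>, and it is nonnegative because
    \<open>a\<close> is. For \<open>a = 0\<close> it is the zero vector, feasible since then
    \<open>b \<le> 0\<close>.\<close>
  moreover have "(\<bar>b\<bar> / (a \<bullet> a)) *\<^sub>R a \<in> ?S"
    using nonneg b by (cases "a = 0") auto
  then have "?S \<noteq> {}" by blast
  ultimately show ?thesis
    using ex1_min_norm_closed_convex[of ?S] by simp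
qed

lemma avec_nonneg:
  assumes "open A" "convex_on A \<eta>" "C2_on A \<eta>" "\<And>j. u $ j \<in> A"
  shows "0 \<le> avec \<eta> D u i $ j"
  using gradient_monotone[of A \<eta> "u $ i" "u $ j"] assms by (simp add: avec_def C2_on_def)

text \<open>This settles the degenerate rows of the quadratic program, where no choice of diffusion
  can affect the constraint.\<close>

lemma bval_eq_0:
  assumes "open A" "convex_on A \<eta>" "C2_on A \<eta>" "\<And>j. u $ j \<in> A"
    and "pos_definite (hessian \<eta> (u $ i))" and a: "avec \<eta> D u i = 0"
  shows "bval \<eta> F f D u i = 0"
proof -
  have "nvec D i j = 0 \<or> u $ j = u $ i" for j
    using gradient_strictly_monotone[of A \<eta> "u $ i" "u $ j"] assms(1-5) arg_cong[OF a, of "\<lambda>x. x $ j"]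
    by (fastforce simp: avec_def)
  then show ?thesis
    unfolding bval_def by (intro sum.neutral) (metis diff_self inner_zero_left mult_eq_0_iff norm_zero)
qed

text \<open>Pairing the viscous term \<open>\<theta> $ j *\<^sub>R (u $ i - u $ j)\<close> with the
  jump of the entropy variables gives minus the corresponding summand of
  \<open>avec \<eta> D u i \<bullet> \<theta>\<close>; the central flux and the potentials give
  \<open>bval\<close>.\<close>

lemma entropy_production_eq:
  "(\<Sum>j\<in>UNIV. norm (nvec D i j) *
      ((gradient \<eta> (u $ j) - gradient \<eta> (u $ i)) \<bullet> flux_visc f D u i j (\<theta> $ j)
        - (entropy_potential \<eta> F f (u $ j) - entropy_potential \<eta> F f (u $ i)) \<bullet> nhat D i j))
   = bval \<eta> F f D u i - avec \<eta> D u i \<bullet> \<theta>"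
  unfolding bval_def inner_vec_def[of "avec \<eta> D u i"] sum_subtractf[symmetric]
  by (intro sum.cong refl) (simp add: avec_def flux_visc_def inner_simps algebra_simps)

text \<open>Rows of \<open>u'\<close> are indexed by nodes, so \<open>M\<close> acts across nodes
  and its diagonal form decouples the scheme into one equation per node.\<close>

lemma diagonal_scheme_row:
  fixes M :: "real ^ 'n ^ 'n" and u' r :: "real ^ 'v ^ 'n"
  assumes diag: "\<And>i j. i \<noteq> j \<Longrightarrow> M $ i $ j = 0" and "M ** u' + r = 0"
  shows "M $ i $ i *\<^sub>R u' $ i = - r $ i"
proof (rule vec_eq_iff[THEN iffD2], rule)
  fix a
  have "(M ** u') $ i $ a = (\<Sum>k\<in>UNIV. if k = i then M $ i $ i * u' $ i $ a else 0)"
    unfolding matrix_matrix_mult_def vec_lambda_beta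
    by (intro sum.cong refl) (use diag in auto)
  then have "(M ** u') $ i $ a = M $ i $ i * u' $ i $ a" by simp
  moreover have "(M ** u') $ i $ a + r $ i $ a = 0"
    using assms(2) by (metis vector_add_component zero_index)
  ultimately show "(M $ i $ i *\<^sub>R u' $ i) $ a = (- r $ i) $ a" by simp
qed

theorem lemma3p3:
  fixes A :: "(real ^ 'v) set"
    and f :: "'d::finite \<Rightarrow> real ^ 'v \<Rightarrow> real ^ 'v"
    and \<eta> :: "real ^ 'v \<Rightarrow> real"
    and F :: "'d \<Rightarrow> real ^ 'v \<Rightarrow> real"
    and M :: "real ^ 'n ^ 'n"
    and D :: "'d \<Rightarrow> real ^ 'n ^ 'n"
    and u :: "real \<Rightarrow> real ^ 'v ^ 'n"
    and t :: real and T :: "real set"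
  assumes "open A" and "convex A"
    and "C2_on A \<eta>" and "convex_on A \<eta>"
    and "\<And>k. entropy_pair_on A \<eta> (F k) (f k)"
    and "\<And>i j. i \<noteq> j \<Longrightarrow> M $ i $ j = 0" and "\<And>i. 0 < M $ i $ i"
    and "\<And>k. D k *v 1 = 0"
    and "\<And>j. u t $ j \<in> A"
    and "\<And>j. pos_definite (hessian \<eta> (u t $ j))"
  shows
    "(\<forall>i. \<exists>!\<theta>. qp_solution \<eta> F f D (u t) i \<theta>) \<and>
     (\<forall>\<theta>hat \<theta> :: real ^ 'n ^ 'n. \<forall>u' :: real ^ 'v ^ 'n.
        (\<forall>i. qp_solution \<eta> F f D (u t) i (\<theta>hat $ i)) \<longrightarrow>
        (\<forall>i j. \<theta> $ i $ j = max (\<theta>hat $ i $ j) (\<theta>hat $ j $ i)) \<longrightarrow>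
        (u has_vector_derivative u') (at t within T) \<longrightarrow>
        M ** u' + residual f D (u t) \<theta> = 0 \<longrightarrow>
        (\<forall>i. gradient \<eta> (u t $ i) \<bullet> (u' $ i) +
              1 / M $ i $ i *
              (\<Sum>j\<in>UNIV. norm (nvec D i j) *
                 (gradient \<eta> (u t $ j) \<bullet> flux_visc f D (u t) i j (\<theta> $ i $ j)
                   - (entropy_potential \<eta> F f (u t $ j) - entropy_potential \<eta> F f (u t $ i))
                       \<bullet> nhat D i j)) \<le> 0))"
proof (intro conjI allI impI)
  fix i
  show "\<exists>!\<theta>. qp_solution \<eta> F f D (u t) i \<theta>"
    unfolding qp_solution_def
    by (intro ex1_min_norm_half_space_orthant)
       (simp_all add: avec_nonneg[OF assms(1,4,3,9)] bval_eq_0[OF assms(1,4,3,9,10)])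
next
  fix \<theta>hat \<theta> :: "real ^ 'n ^ 'n" and u' :: "real ^ 'v ^ 'n" and i
  assume sol: "\<forall>i. qp_solution \<eta> F f D (u t) i (\<theta>hat $ i)"
    and max: "\<forall>i j. \<theta> $ i $ j = max (\<theta>hat $ i $ j) (\<theta>hat $ j $ i)"
    and scheme: "M ** u' + residual f D (u t) \<theta> = 0"
  let ?g = "\<lambda>j. gradient \<eta> (u t $ j)" and ?f = "\<lambda>j. flux_visc f D (u t) i j (\<theta> $ i $ j)"
    and ?\<psi> = "\<lambda>j. (entropy_potential \<eta> F f (u t $ j) - entropy_potential \<eta> F f (u t $ i)) \<bullet> nhat D i j"
  have m: "0 < M $ i $ i" by (rule assms(7))
  have "M $ i $ i *\<^sub>R u' $ i = - residual f D (u t) \<theta> $ i"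
    using assms(6) scheme by (rule diagonal_scheme_row)
  then have "?g i \<bullet> (M $ i $ i *\<^sub>R u' $ i) = - (\<Sum>j\<in>UNIV. norm (nvec D i j) * (?g i \<bullet> ?f j))"
    by (simp add: residual_def inner_sum_right)
  \<comment> \<open>The scheme replaces the time derivative by minus the fluxes paired with
    \<open>?g i\<close>, which turns each \<open>?g j\<close> in the sum into the jump
    \<open>?g j - ?g i\<close>.\<close>
  then have "M $ i $ i * (?g i \<bullet> u' $ i) + (\<Sum>j\<in>UNIV. norm (nvec D i j) * (?g j \<bullet> ?f j - ?\<psi> j))
      = (\<Sum>j\<in>UNIV. norm (nvec D i j) * ((?g j - ?g i) \<bullet> ?f j - ?\<psi> j))"
    by (simp add: sum_subtractf[symmetric] inner_diff_left algebra_simps)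
  also have "\<dots> = bval \<eta> F f D (u t) i - avec \<eta> D (u t) i \<bullet> \<theta> $ i"
    by (rule entropy_production_eq)
  also have "\<dots> \<le> bval \<eta> F f D (u t) i - avec \<eta> D (u t) i \<bullet> \<theta>hat $ i"
    using avec_nonneg[OF assms(1,4,3,9)] max
    by (auto simp: inner_vec_def intro!: sum_mono mult_left_mono)
  \<comment> \<open>Feasibility of the minimizer is exactly this inequality.\<close>
  also have "\<dots> \<le> 0"
    using sol by (simp add: qp_solution_def is_arg_min_def)
  finally show "?g i \<bullet> (u' $ i) + 1 / M $ i $ i *
      (\<Sum>j\<in>UNIV. norm (nvec D i j) * (?g j \<bullet> ?f j - ?\<psi> j)) \<le> 0"
    using m by (simp add: field_simps)
qed

end
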